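(* The full subcategory of $\mathbf{SCvx}$ consisting of the single object $\Delta_{\mathbb{N}}$ is a dense subcategory of $\mathbf{SCvx}$.
   Context: $\mathbb{N}=\{0,1,2,\dots\}$. $\mathcal{G}\mathbb{N}$ is the set of sequences $\mathbf{p}:\mathbb{N}\to[0,1]$ with $\sum_i p_i=1$, identified with the probability measures $\sum_i p_i\delta_i$ on $\mathbb{N}$. A super convex space is a set $A$ with a function $\mathcal{G}\mathbb{N}\times A^{\mathbb{N}}\to A$, $(\mathbf{p},\mathbf{a})\mapsto\sum_{i\in\mathbb{N}}p_ia_i$, such that (1) for $\mathbf{p}=\delta_j$ the value is $a_j$, and (2) $\sum_j p_j(\sum_i Q^j_i a_i)=\sum_i(\sum_j p_jQ^j_i)a_i$ for all $\mathbf{p}\in\mathcal{G}\mathbb{N}$, all sequences $\mathbf{Q}:\mathbb{N}\to\mathcal{G}\mathbb{N}$ and all $\mathbf{a}:\mathbb{N}\to A$. A countably affine map is a function $m$ with $m(\sum_i p_ia_i)=\sum_i p_i m(a_i)$ always. Super convex spaces and countably affine maps form the category $\mathbf{SCvx}$. $\Delta_{\mathbb{N}}$ is the set $\mathcal{G}\mathbb{N}$ as a super convex space with countably affine sums taken coefficientwise. A full subcategory $\mathcal{D}$ of $\mathcal{C}$ is dense if the restricted Yoneda functor $\mathcal{C}\to\mathbf{Set}^{\mathcal{D}^{op}}$, $A\mapsto\mathcal{C}(\_,A)$, is full and faithful. *)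

theory Defs
  imports Complex_Main "HOL-Library.FuncSet"
begin

section \<open>Categories and functors\<close>

text \<open>
  Hom-sets of different pairs of objects need not be disjoint, so composition and the action of a
  functor on arrows carry the objects as arguments: \<open>Comp C X Y Z g f\<close> is the composite of
  \<open>f : X \<rightarrow> Y\<close> and \<open>g : Y \<rightarrow> Z\<close>. Functors, natural transformations and functions between sets are
  extensional (\<^const>\<open>undefined\<close> outside their domain), so that equality in the logic is equality
  of the mathematical objects.
\<close>

record ('o, 'm) cat =
  Obj :: "'o set"
  Hom :: "'o \<Rightarrow> 'o \<Rightarrow> 'm set"
  Ident :: "'o \<Rightarrow> 'm"
  Comp :: "'o \<Rightarrow> 'o \<Rightarrow> 'o \<Rightarrow> 'm \<Rightarrow> 'm \<Rightarrow> 'm"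

locale category =
  fixes C :: "('o, 'm) cat"
  assumes Ident_in_Hom: "X \<in> Obj C \<Longrightarrow> Ident C X \<in> Hom C X X"
    and Comp_in_Hom:
      "\<lbrakk>X \<in> Obj C; Y \<in> Obj C; Z \<in> Obj C; f \<in> Hom C X Y; g \<in> Hom C Y Z\<rbrakk>
        \<Longrightarrow> Comp C X Y Z g f \<in> Hom C X Z"
    and Comp_Ident_left:
      "\<lbrakk>X \<in> Obj C; Y \<in> Obj C; f \<in> Hom C X Y\<rbrakk> \<Longrightarrow> Comp C X Y Y (Ident C Y) f = f"
    and Comp_Ident_right:
      "\<lbrakk>X \<in> Obj C; Y \<in> Obj C; f \<in> Hom C X Y\<rbrakk> \<Longrightarrow> Comp C X X Y f (Ident C X) = f"
    and Comp_assoc: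
      "\<lbrakk>W \<in> Obj C; X \<in> Obj C; Y \<in> Obj C; Z \<in> Obj C;
        f \<in> Hom C W X; g \<in> Hom C X Y; h \<in> Hom C Y Z\<rbrakk>
        \<Longrightarrow> Comp C W Y Z h (Comp C W X Y g f) = Comp C W X Z (Comp C X Y Z h g) f"

definition op_cat :: "('o, 'm) cat \<Rightarrow> ('o, 'm) cat" where
  "op_cat C = \<lparr>Obj = Obj C, Hom = (\<lambda>X Y. Hom C Y X), Ident = Ident C,
     Comp = (\<lambda>X Y Z g f. Comp C Z Y X f g)\<rparr>"

definition full_on :: "('o, 'm) cat \<Rightarrow> 'o set \<Rightarrow> ('o, 'm) cat" where
  "full_on C S = C\<lparr>Obj := S\<rparr>"

locale full_subcategory = category C for D C :: "('o, 'm) cat" +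
  assumes Obj_subset: "Obj D \<subseteq> Obj C"
    and Hom_eq: "\<lbrakk>X \<in> Obj D; Y \<in> Obj D\<rbrakk> \<Longrightarrow> Hom D X Y = Hom C X Y"
    and Ident_eq: "X \<in> Obj D \<Longrightarrow> Ident D X = Ident C X"
    and Comp_eq:
      "\<lbrakk>X \<in> Obj D; Y \<in> Obj D; Z \<in> Obj D; f \<in> Hom D X Y; g \<in> Hom D Y Z\<rbrakk>
        \<Longrightarrow> Comp D X Y Z g f = Comp C X Y Z g f"

record ('o, 'm, 'p, 'n) fctr =
  FObj :: "'o \<Rightarrow> 'p"
  FArr :: "'o \<times> 'o \<Rightarrow> 'm \<Rightarrow> 'n"

locale cat_functor = dom: category C + cod: category D
  for C :: "('o, 'm) cat" and D :: "('p, 'n) cat" +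
  fixes F :: "('o, 'm, 'p, 'n) fctr"
  assumes FObj_type: "FObj F \<in> Obj C \<rightarrow>\<^sub>E Obj D"
    and FArr_type:
      "FArr F \<in> (\<Pi>\<^sub>E (X, Y)\<in>Obj C \<times> Obj C. Hom C X Y \<rightarrow>\<^sub>E Hom D (FObj F X) (FObj F Y))"
    and FArr_Ident: "X \<in> Obj C \<Longrightarrow> FArr F (X, X) (Ident C X) = Ident D (FObj F X)"
    and FArr_Comp:
      "\<lbrakk>X \<in> Obj C; Y \<in> Obj C; Z \<in> Obj C; f \<in> Hom C X Y; g \<in> Hom C Y Z\<rbrakk>
        \<Longrightarrow> FArr F (X, Z) (Comp C X Y Z g f)
          = Comp D (FObj F X) (FObj F Y) (FObj F Z) (FArr F (Y, Z) g) (FArr F (X, Y) f)"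

definition full_functor ::
    "('o, 'm) cat \<Rightarrow> ('p, 'n) cat \<Rightarrow> ('o, 'm, 'p, 'n) fctr \<Rightarrow> bool" where
  "full_functor C D F \<longleftrightarrow>
     (\<forall>A\<in>Obj C. \<forall>B\<in>Obj C. FArr F (A, B) ` Hom C A B = Hom D (FObj F A) (FObj F B))"

definition faithful_functor ::
    "('o, 'm) cat \<Rightarrow> ('p, 'n) cat \<Rightarrow> ('o, 'm, 'p, 'n) fctr \<Rightarrow> bool" where
  "faithful_functor C D F \<longleftrightarrow> (\<forall>A\<in>Obj C. \<forall>B\<in>Obj C. inj_on (FArr F (A, B)) (Hom C A B))"

definition nat_trans ::
    "('o, 'm) cat \<Rightarrow> ('p, 'n) cat \<Rightarrow> ('o, 'm, 'p, 'n) fctr \<Rightarrow> ('o, 'm, 'p, 'n) fctr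
      \<Rightarrow> ('o \<Rightarrow> 'n) set" where
  "nat_trans C D F G =
     {\<tau> \<in> (\<Pi>\<^sub>E X\<in>Obj C. Hom D (FObj F X) (FObj G X)).
       \<forall>X\<in>Obj C. \<forall>Y\<in>Obj C. \<forall>u\<in>Hom C X Y.
         Comp D (FObj F X) (FObj F Y) (FObj G Y) (\<tau> Y) (FArr F (X, Y) u)
         = Comp D (FObj F X) (FObj G X) (FObj G Y) (FArr G (X, Y) u) (\<tau> X)}"

definition functor_cat ::
    "('o, 'm) cat \<Rightarrow> ('p, 'n) cat \<Rightarrow> (('o, 'm, 'p, 'n) fctr, 'o \<Rightarrow> 'n) cat" where
  "functor_cat C D =
     \<lparr>Obj = {F. cat_functor C D F},
      Hom = nat_trans C D,
      Ident = (\<lambda>F. \<lambda>X\<in>Obj C. Ident D (FObj F X)),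
      Comp = (\<lambda>F G H \<sigma> \<tau>. \<lambda>X\<in>Obj C. Comp D (FObj F X) (FObj G X) (FObj H X) (\<sigma> X) (\<tau> X))\<rparr>"

text \<open>
  The category of sets whose elements lie in a given type. Below that type is the type of arrows
  of the category under consideration, so all hom-sets are objects.
\<close>

definition Set_cat :: "('x set, 'x \<Rightarrow> 'x) cat" where
  "Set_cat = \<lparr>Obj = UNIV, Hom = (\<lambda>X Y. X \<rightarrow>\<^sub>E Y), Ident = (\<lambda>X. \<lambda>x\<in>X. x),
     Comp = (\<lambda>X Y Z g f. compose X g f)\<rparr>"


section \<open>Dense subcategories\<close>

definition restricted_hom ::
    "('o, 'm) cat \<Rightarrow> ('o, 'm) cat \<Rightarrow> 'o \<Rightarrow> ('o, 'm, 'm set, 'm \<Rightarrow> 'm) fctr" where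
  "restricted_hom C D A =
     \<lparr>FObj = (\<lambda>X\<in>Obj D. Hom C X A),
      FArr = (\<lambda>(X, Y)\<in>Obj D \<times> Obj D. \<lambda>u\<in>Hom D Y X. \<lambda>f\<in>Hom C X A. Comp C Y X A f u)\<rparr>"

definition restricted_yoneda ::
    "('o, 'm) cat \<Rightarrow> ('o, 'm) cat
      \<Rightarrow> ('o, 'm, ('o, 'm, 'm set, 'm \<Rightarrow> 'm) fctr, 'o \<Rightarrow> 'm \<Rightarrow> 'm) fctr" where
  "restricted_yoneda C D =
     \<lparr>FObj = (\<lambda>A\<in>Obj C. restricted_hom C D A),
      FArr = (\<lambda>(A, B)\<in>Obj C \<times> Obj C. \<lambda>m\<in>Hom C A B.
                \<lambda>X\<in>Obj D. \<lambda>f\<in>Hom C X A. Comp C X A B m f)\<rparr>"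

locale dense_subcategory = full_subcategory D C for D C :: "('o, 'm) cat" +
  assumes yoneda_functor:
      "cat_functor C (functor_cat (op_cat D) Set_cat) (restricted_yoneda C D)"
    and yoneda_full:
      "full_functor C (functor_cat (op_cat D) Set_cat) (restricted_yoneda C D)"
    and yoneda_faithful:
      "faithful_functor C (functor_cat (op_cat D) Set_cat) (restricted_yoneda C D)"


section \<open>Super convex spaces\<close>

definition GN :: "(nat \<Rightarrow> real) set" where
  "GN = {p. (\<forall>i. 0 \<le> p i \<and> p i \<le> 1) \<and> p sums 1}"

definition dirac :: "nat \<Rightarrow> nat \<Rightarrow> real" where
  "dirac j = (\<lambda>i. if i = j then 1 else 0)"

text \<open>The coefficientwise countable sum \<open>\<Sum>\<^sub>j p\<^sub>j Q\<^sup>j\<close>.\<close>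

definition mix :: "(nat \<Rightarrow> real) \<Rightarrow> (nat \<Rightarrow> nat \<Rightarrow> real) \<Rightarrow> nat \<Rightarrow> real" where
  "mix p Q = (\<lambda>i. \<Sum>j. p j * Q j i)"

record 'a scvx =
  carrier :: "'a set"
  csum :: "(nat \<Rightarrow> real) \<times> (nat \<Rightarrow> 'a) \<Rightarrow> 'a"

locale super_convex_space =
  fixes A :: "'a scvx"
  assumes csum_type: "csum A \<in> GN \<times> (UNIV \<rightarrow> carrier A) \<rightarrow>\<^sub>E carrier A"
    and csum_dirac: "a \<in> UNIV \<rightarrow> carrier A \<Longrightarrow> csum A (dirac j, a) = a j"
    and csum_csum:
      "\<lbrakk>p \<in> GN; Q \<in> UNIV \<rightarrow> GN; a \<in> UNIV \<rightarrow> carrier A\<rbrakk>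
        \<Longrightarrow> csum A (p, \<lambda>j. csum A (Q j, a)) = csum A (mix p Q, a)"

definition countably_affine_maps :: "'a scvx \<Rightarrow> 'b scvx \<Rightarrow> ('a \<Rightarrow> 'b) set" where
  "countably_affine_maps A B =
     {m \<in> carrier A \<rightarrow>\<^sub>E carrier B.
       \<forall>p\<in>GN. \<forall>a\<in>UNIV \<rightarrow> carrier A. m (csum A (p, a)) = csum B (p, \<lambda>i. m (a i))}"

text \<open>The super convex spaces whose points lie in the type \<^typ>\<open>'u\<close>, which acts as a universe.\<close>

definition SCvx :: "('u scvx, 'u \<Rightarrow> 'u) cat" where
  "SCvx =
     \<lparr>Obj = {A. super_convex_space A},
      Hom = countably_affine_maps,
      Ident = (\<lambda>A. \<lambda>x\<in>carrier A. x),
      Comp = (\<lambda>A B C g f. compose (carrier A) g f)\<rparr>"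

definition Delta_N :: "(nat \<Rightarrow> real) scvx" where
  "Delta_N = \<lparr>carrier = GN, csum = (\<lambda>(p, Q)\<in>GN \<times> (UNIV \<rightarrow> GN). mix p Q)\<rparr>"

text \<open>
  The copy of a space \<open>A\<close> obtained by renaming its points along \<open>e\<close>, assumed injective on the
  carrier. It places \<^const>\<open>Delta_N\<close> into the universe over which \<^const>\<open>SCvx\<close> is formed.
\<close>

definition relabel :: "('a \<Rightarrow> 'u) \<Rightarrow> 'a scvx \<Rightarrow> 'u scvx" where
  "relabel e A =
     \<lparr>carrier = e ` carrier A,
      csum = (\<lambda>(p, a)\<in>GN \<times> (UNIV \<rightarrow> e ` carrier A).
                e (csum A (p, \<lambda>i. inv_into (carrier A) e (a i))))\<rparr>"

end

theory Submission
  imports Defs "HOL-Analysis.Infinite_Sum" "HOL-Analysis.Elementary_Metric_Spaces"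
begin

text \<open>
  Let \<open>D\<close> be the space of probability measures on the natural numbers, with its points
  possibly renamed, and let \<open>d j\<close> be the Dirac measure at \<open>j\<close>. For a super convex space \<open>A\<close>, the
  affine maps from \<open>D\<close> to \<open>A\<close> see two things. Constant maps see the points of \<open>A\<close>. The map
  \<open>p \<mapsto> \<Sum>\<^sub>i p\<^sub>i a\<^sub>i\<close> attached to a sequence \<open>a\<close> sees the countable sums along \<open>a\<close>; it is affine
  because of axiom (2) and sends \<open>d j\<close> to \<open>a j\<close> because of axiom (1).

  Faithfulness: a map \<open>m\<close> out of \<open>A\<close> is recovered from its composites with constant maps.

  Fullness: let \<open>\<tau>\<close> send affine maps from \<open>D\<close> to \<open>A\<close> to affine maps from \<open>D\<close> to \<open>B\<close>, naturally
  with respect to precomposition by affine endomaps of \<open>D\<close>. Put \<open>m x = \<tau> (const x) (d 0)\<close>.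
  Naturality with respect to the endomap of \<open>D\<close> that is constant at \<open>y\<close> gives
  \<open>\<tau> f y = \<tau> (const (f y)) (d 0) = m (f y)\<close>, so \<open>\<tau>\<close> is postcomposition with the function \<open>m\<close>. That
  \<open>m\<close> is countably affine is then inherited from the affine maps \<open>\<tau> f\<close>: if \<open>f\<close> sends \<open>d j\<close> to
  \<open>a j\<close>, then
  \<open>m (\<Sum>\<^sub>i p\<^sub>i a\<^sub>i) = \<tau> f (\<Sum>\<^sub>i p\<^sub>i d\<^sub>i) = \<Sum>\<^sub>i p\<^sub>i \<tau> f (d i) = \<Sum>\<^sub>i p\<^sub>i m (a i)\<close>.

  What the argument needs of \<open>D\<close> is that every sequence in every space is the image of \<open>d\<close> under
  some affine map; in this form it is \<open>dense_if_interpolates_sequences\<close>. That \<open>D\<close> is a super convex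
  space at all comes down to interchanging double sums of nonnegative numbers, in
  \<open>sums_interchange_nonneg\<close>.
\<close>

section \<open>The restricted Yoneda functor of a full subcategory\<close>

lemma category_op_cat:
  assumes "category C"
  shows "category (op_cat C)"
proof -
  interpret category C by fact
  show ?thesis
    by standard
      (simp_all add: op_cat_def Ident_in_Hom Comp_in_Hom Comp_Ident_left Comp_Ident_right Comp_assoc)
qed

lemma category_Set_cat: "category Set_cat"
proof
  fix X Y :: "'a set" and f
  assume "f \<in> Hom Set_cat X Y"
  then show "Comp Set_cat X Y Y (Ident Set_cat Y) f = f"
    and "Comp Set_cat X X Y f (Ident Set_cat X) = f"
    by (auto simp: Set_cat_def compose_def PiE_iff fun_eq_iff extensional_def)
next
  fix W X Y Z :: "'a set" and f g h
  assume "f \<in> Hom Set_cat W X"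
  then show "Comp Set_cat W Y Z h (Comp Set_cat W X Y g f)
      = Comp Set_cat W X Z (Comp Set_cat X Y Z h g) f"
    by (auto simp: Set_cat_def compose_def fun_eq_iff)
qed (auto simp: Set_cat_def compose_def PiE_iff)

lemma category_functor_cat:
  assumes "category C" "category D"
  shows "category (functor_cat C D)"
proof -
  interpret C: category C by fact
  interpret D: category D by fact
  have FObj: "FObj F X \<in> Obj D" if "cat_functor C D F" "X \<in> Obj C" for F X
    using cat_functor.FObj_type[OF that(1)] that(2) by (auto simp: PiE_iff)
  have FArr: "FArr F (X, Y) u \<in> Hom D (FObj F X) (FObj F Y)"
    if "cat_functor C D F" "X \<in> Obj C" "Y \<in> Obj C" "u \<in> Hom C X Y" for F X Y u
    using cat_functor.FArr_type[OF that(1)] that(2-) by (force simp: PiE_iff)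
  have nt: "\<tau> X \<in> Hom D (FObj F X) (FObj G X)"
    if "\<tau> \<in> nat_trans C D F G" "X \<in> Obj C" for \<tau> F G X
    using that by (auto simp: nat_trans_def PiE_iff)
  have nt_ext: "\<tau> X = undefined"
    if "\<tau> \<in> nat_trans C D F G" "X \<notin> Obj C" for \<tau> F G X
    using that by (auto simp: nat_trans_def PiE_iff extensional_def)
  have natural: "Comp D (FObj F X) (FObj F Y) (FObj G Y) (\<tau> Y) (FArr F (X, Y) u)
         = Comp D (FObj F X) (FObj G X) (FObj G Y) (FArr G (X, Y) u) (\<tau> X)"
    if "\<tau> \<in> nat_trans C D F G" "X \<in> Obj C" "Y \<in> Obj C" "u \<in> Hom C X Y" for \<tau> F G X Y u
    using that by (auto simp: nat_trans_def)
  show ?thesis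
  proof
    fix F
    assume "F \<in> Obj (functor_cat C D)"
    then have F: "cat_functor C D F" by (simp add: functor_cat_def)
    show "Ident (functor_cat C D) F \<in> Hom (functor_cat C D) F F"
      by (auto simp: functor_cat_def nat_trans_def FObj[OF F] FArr[OF F] D.Ident_in_Hom
          D.Comp_Ident_left D.Comp_Ident_right)
  next
    fix F G H \<tau> \<sigma>
    assume "F \<in> Obj (functor_cat C D)" "G \<in> Obj (functor_cat C D)" "H \<in> Obj (functor_cat C D)"
    then have F: "cat_functor C D F" and G: "cat_functor C D G" and H: "cat_functor C D H"
      by (simp_all add: functor_cat_def)
    assume "\<tau> \<in> Hom (functor_cat C D) F G" "\<sigma> \<in> Hom (functor_cat C D) G H"
    then have \<tau>: "\<tau> \<in> nat_trans C D F G" and \<sigma>: "\<sigma> \<in> nat_trans C D G H"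
      by (simp_all add: functor_cat_def)
    let ?c = "\<lambda>X. Comp D (FObj F X) (FObj G X) (FObj H X) (\<sigma> X) (\<tau> X)"
    have "Comp D (FObj F X) (FObj F Y) (FObj H Y) (?c Y) (FArr F (X, Y) u)
        = Comp D (FObj F X) (FObj H X) (FObj H Y) (FArr H (X, Y) u) (?c X)"
      if X: "X \<in> Obj C" and Y: "Y \<in> Obj C" and u: "u \<in> Hom C X Y" for X Y u
    proof -
      note t = FObj[OF F X] FObj[OF F Y] FObj[OF G X] FObj[OF G Y] FObj[OF H X] FObj[OF H Y]
        FArr[OF F X Y u] FArr[OF G X Y u] FArr[OF H X Y u]
        nt[OF \<tau> X] nt[OF \<tau> Y] nt[OF \<sigma> X] nt[OF \<sigma> Y]
      have "Comp D (FObj F X) (FObj F Y) (FObj H Y) (?c Y) (FArr F (X, Y) u)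
          = Comp D (FObj F X) (FObj G Y) (FObj H Y) (\<sigma> Y)
              (Comp D (FObj F X) (FObj F Y) (FObj G Y) (\<tau> Y) (FArr F (X, Y) u))"
        using t by (simp add: D.Comp_assoc)
      also have "\<dots> = Comp D (FObj F X) (FObj G X) (FObj H Y)
              (Comp D (FObj G X) (FObj G Y) (FObj H Y) (\<sigma> Y) (FArr G (X, Y) u)) (\<tau> X)"
        using t by (simp add: D.Comp_assoc natural[OF \<tau> X Y u])
      also have "\<dots> = Comp D (FObj F X) (FObj H X) (FObj H Y) (FArr H (X, Y) u) (?c X)"
        using t by (simp add: D.Comp_assoc natural[OF \<sigma> X Y u])
      finally show ?thesis .
    qed
    then show "Comp (functor_cat C D) F G H \<sigma> \<tau> \<in> Hom (functor_cat C D) F H"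
      using FObj[OF F] FObj[OF G] FObj[OF H] nt[OF \<tau>] nt[OF \<sigma>]
      by (auto simp: functor_cat_def nat_trans_def intro!: D.Comp_in_Hom)
  next
    fix F G \<tau>
    assume "F \<in> Obj (functor_cat C D)" "G \<in> Obj (functor_cat C D)"
    then have F: "cat_functor C D F" and G: "cat_functor C D G"
      by (simp_all add: functor_cat_def)
    assume "\<tau> \<in> Hom (functor_cat C D) F G"
    then have \<tau>: "\<tau> \<in> nat_trans C D F G"
      by (simp_all add: functor_cat_def)
    show "Comp (functor_cat C D) F G G (Ident (functor_cat C D) G) \<tau> = \<tau>"
      and "Comp (functor_cat C D) F F G \<tau> (Ident (functor_cat C D) F) = \<tau>"
      by (auto simp: functor_cat_def fun_eq_iff restrict_def nt_ext[OF \<tau>]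
          D.Comp_Ident_left[OF FObj[OF F] FObj[OF G] nt[OF \<tau>]]
          D.Comp_Ident_right[OF FObj[OF F] FObj[OF G] nt[OF \<tau>]])
  next
    fix E F G H \<rho> \<tau> \<sigma>
    assume "E \<in> Obj (functor_cat C D)" "F \<in> Obj (functor_cat C D)"
      "G \<in> Obj (functor_cat C D)" "H \<in> Obj (functor_cat C D)"
    then have E: "cat_functor C D E" and F: "cat_functor C D F"
      and G: "cat_functor C D G" and H: "cat_functor C D H"
      by (simp_all add: functor_cat_def)
    assume "\<rho> \<in> Hom (functor_cat C D) E F" "\<tau> \<in> Hom (functor_cat C D) F G"
      "\<sigma> \<in> Hom (functor_cat C D) G H"
    then have \<rho>: "\<rho> \<in> nat_trans C D E F" and \<tau>: "\<tau> \<in> nat_trans C D F G"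
      and \<sigma>: "\<sigma> \<in> nat_trans C D G H"
      by (simp_all add: functor_cat_def)
    show "Comp (functor_cat C D) E G H \<sigma> (Comp (functor_cat C D) E F G \<tau> \<rho>)
        = Comp (functor_cat C D) E F H (Comp (functor_cat C D) F G H \<sigma> \<tau>) \<rho>"
      by (auto simp: functor_cat_def fun_eq_iff restrict_def
          D.Comp_assoc[OF FObj[OF E] FObj[OF F] FObj[OF G] FObj[OF H] nt[OF \<rho>] nt[OF \<tau>] nt[OF \<sigma>]])
  qed
qed

context full_subcategory
begin

lemma category_sub: "category D"
proof
  fix X assume "X \<in> Obj D"
  then show "Ident D X \<in> Hom D X X"
    using Obj_subset by (auto simp: Hom_eq Ident_eq Ident_in_Hom)
next
  fix X Y Z f g
  assume "X \<in> Obj D" "Y \<in> Obj D" "Z \<in> Obj D" "f \<in> Hom D X Y" "g \<in> Hom D Y Z"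
  then show "Comp D X Y Z g f \<in> Hom D X Z"
    using Obj_subset by (auto simp: Hom_eq Comp_eq Comp_in_Hom subset_iff)
next
  fix X Y f
  assume "X \<in> Obj D" "Y \<in> Obj D" "f \<in> Hom D X Y"
  then show "Comp D X Y Y (Ident D Y) f = f" "Comp D X X Y f (Ident D X) = f"
    using Obj_subset
    by (auto simp: Hom_eq Comp_eq Ident_eq Ident_in_Hom Comp_Ident_left Comp_Ident_right subset_iff)
next
  fix W X Y Z f g h
  assume "W \<in> Obj D" "X \<in> Obj D" "Y \<in> Obj D" "Z \<in> Obj D"
    "f \<in> Hom D W X" "g \<in> Hom D X Y" "h \<in> Hom D Y Z"
  then show "Comp D W Y Z h (Comp D W X Y g f) = Comp D W X Z (Comp D X Y Z h g) f"
    using Obj_subset by (auto simp: Hom_eq Comp_eq Comp_in_Hom Comp_assoc subset_iff)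
qed

lemma cat_functor_restricted_hom:
  assumes A: "A \<in> Obj C"
  shows "cat_functor (op_cat D) Set_cat (restricted_hom C D A)"
proof (intro cat_functor.intro cat_functor_axioms.intro)
  show "category (op_cat D)" by (intro category_op_cat category_sub)
  show "category Set_cat" by (rule category_Set_cat)
  show "FObj (restricted_hom C D A) \<in> Obj (op_cat D) \<rightarrow>\<^sub>E Obj Set_cat"
    by (simp add: restricted_hom_def op_cat_def Set_cat_def)
  show "FArr (restricted_hom C D A) \<in> (\<Pi>\<^sub>E (X, Y)\<in>Obj (op_cat D) \<times> Obj (op_cat D).
      Hom (op_cat D) X Y \<rightarrow>\<^sub>E
        Hom Set_cat (FObj (restricted_hom C D A) X) (FObj (restricted_hom C D A) Y))"
    using A Obj_subset
    by (auto simp: restricted_hom_def op_cat_def Set_cat_def Hom_eq subset_iff intro!: Comp_in_Hom)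
next
  fix X assume "X \<in> Obj (op_cat D)"
  then show "FArr (restricted_hom C D A) (X, X) (Ident (op_cat D) X)
      = Ident Set_cat (FObj (restricted_hom C D A) X)"
    using A Obj_subset
    by (auto simp: restricted_hom_def op_cat_def Set_cat_def Hom_eq Ident_eq Ident_in_Hom
        Comp_Ident_right subset_iff fun_eq_iff)
next
  fix X Y Z f g
  assume "X \<in> Obj (op_cat D)" "Y \<in> Obj (op_cat D)" "Z \<in> Obj (op_cat D)"
    "f \<in> Hom (op_cat D) X Y" "g \<in> Hom (op_cat D) Y Z"
  then show "FArr (restricted_hom C D A) (X, Z) (Comp (op_cat D) X Y Z g f)
      = Comp Set_cat (FObj (restricted_hom C D A) X) (FObj (restricted_hom C D A) Y)
          (FObj (restricted_hom C D A) Z)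
          (FArr (restricted_hom C D A) (Y, Z) g) (FArr (restricted_hom C D A) (X, Y) f)"
    using A Obj_subset
    by (auto simp: restricted_hom_def op_cat_def Set_cat_def Hom_eq Comp_eq Comp_in_Hom
        Comp_assoc subset_iff fun_eq_iff compose_def)
qed

lemma restricted_yoneda_arr:
  assumes A: "A \<in> Obj C" and B: "B \<in> Obj C" and m: "m \<in> Hom C A B"
  shows "FArr (restricted_yoneda C D) (A, B) m
    \<in> nat_trans (op_cat D) Set_cat (restricted_hom C D A) (restricted_hom C D B)"
  using assms Obj_subset
  by (auto simp: restricted_yoneda_def nat_trans_def restricted_hom_def op_cat_def Set_cat_def
      Hom_eq Comp_in_Hom Comp_assoc subset_iff fun_eq_iff compose_def)

text \<open>
  Functoriality of the restricted Yoneda functor is associativity and unitality of composition,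
  and does not depend on the category, so it is established for every full subcategory.
\<close>

lemma cat_functor_restricted_yoneda:
  "cat_functor C (functor_cat (op_cat D) Set_cat) (restricted_yoneda C D)"
proof (intro cat_functor.intro cat_functor_axioms.intro)
  show "category C" by (rule category_axioms)
  show "category (functor_cat (op_cat D) Set_cat)"
    by (intro category_functor_cat category_op_cat category_sub category_Set_cat)
  show "FObj (restricted_yoneda C D) \<in> Obj C \<rightarrow>\<^sub>E Obj (functor_cat (op_cat D) Set_cat)"
    by (auto simp: restricted_yoneda_def functor_cat_def cat_functor_restricted_hom)
  show "FArr (restricted_yoneda C D) \<in> (\<Pi>\<^sub>E (A, B)\<in>Obj C \<times> Obj C.
      Hom C A B \<rightarrow>\<^sub>E Hom (functor_cat (op_cat D) Set_cat)
        (FObj (restricted_yoneda C D) A) (FObj (restricted_yoneda C D) B))"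
  proof (rule PiE_I)
    fix x assume "x \<in> Obj C \<times> Obj C"
    then obtain A B where x: "x = (A, B)" and AB: "A \<in> Obj C" "B \<in> Obj C" by auto
    have "FArr (restricted_yoneda C D) (A, B) \<in> extensional (Hom C A B)"
      using AB by (simp add: restricted_yoneda_def)
    then show "FArr (restricted_yoneda C D) x \<in> (case x of (A, B) \<Rightarrow>
      Hom C A B \<rightarrow>\<^sub>E Hom (functor_cat (op_cat D) Set_cat)
        (FObj (restricted_yoneda C D) A) (FObj (restricted_yoneda C D) B))"
      using restricted_yoneda_arr[OF AB] AB
      by (simp add: x PiE_iff functor_cat_def) (simp add: restricted_yoneda_def)
  qed (simp add: restricted_yoneda_def)
next
  fix A assume "A \<in> Obj C"
  then show "FArr (restricted_yoneda C D) (A, A) (Ident C A)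
      = Ident (functor_cat (op_cat D) Set_cat) (FObj (restricted_yoneda C D) A)"
    using Obj_subset
    by (auto simp: restricted_yoneda_def functor_cat_def restricted_hom_def op_cat_def Set_cat_def
        Ident_in_Hom Comp_Ident_left subset_iff fun_eq_iff)
next
  fix X Y Z f g
  assume "X \<in> Obj C" "Y \<in> Obj C" "Z \<in> Obj C" "f \<in> Hom C X Y" "g \<in> Hom C Y Z"
  then show "FArr (restricted_yoneda C D) (X, Z) (Comp C X Y Z g f)
      = Comp (functor_cat (op_cat D) Set_cat) (FObj (restricted_yoneda C D) X)
          (FObj (restricted_yoneda C D) Y) (FObj (restricted_yoneda C D) Z)
          (FArr (restricted_yoneda C D) (Y, Z) g) (FArr (restricted_yoneda C D) (X, Y) f)"
    using Obj_subset
    by (auto simp: restricted_yoneda_def functor_cat_def restricted_hom_def op_cat_def Set_cat_def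
        Comp_in_Hom Comp_assoc subset_iff fun_eq_iff compose_def)
qed

end

lemma full_subcategory_full_on:
  assumes "category C" "S \<subseteq> Obj C"
  shows "full_subcategory (full_on C S) C"
  using assms by (simp add: full_subcategory_def full_subcategory_axioms_def full_on_def)


section \<open>Countably affine maps\<close>

lemma dirac_in_GN: "dirac j \<in> GN"
  using sums_single[of j "\<lambda>_. 1::real"] by (simp add: GN_def dirac_def)

lemma mix_dirac_left: "mix (dirac j) Q = Q j"
proof
  fix i
  have "(\<lambda>k. dirac j k * Q k i) = (\<lambda>k. if k = j then Q k i else 0)"
    by (auto simp: dirac_def)
  then show "mix (dirac j) Q i = Q j i"
    using sums_single[of j "\<lambda>k. Q k i"] by (simp add: mix_def sums_iff)
qed

lemma mix_const:
  assumes "p \<in> GN"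
  shows "mix p (\<lambda>_. q) = q"
  using assms
  by (auto simp: mix_def GN_def fun_eq_iff sums_iff simp flip: suminf_mult2)

lemma (in super_convex_space) csum_closed:
  "\<lbrakk>p \<in> GN; a \<in> UNIV \<rightarrow> carrier A\<rbrakk> \<Longrightarrow> csum A (p, a) \<in> carrier A"
  using csum_type by (auto simp: PiE_iff)

text \<open>
  Idempotency is not an axiom, but writing \<open>x\<close> as the Dirac sum at index 0 turns the sum of
  copies of \<open>x\<close> into an iterated sum, whose mixed weights are again the Dirac weights at 0.
\<close>

lemma (in super_convex_space) csum_const:
  assumes p: "p \<in> GN" and x: "x \<in> carrier A"
  shows "csum A (p, \<lambda>_. x) = x"
proof -
  have x': "(\<lambda>_. x) \<in> UNIV \<rightarrow> carrier A" using x by simp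
  have "csum A (p, \<lambda>_. x) = csum A (p, \<lambda>j. csum A (dirac 0, \<lambda>_. x))"
    by (simp add: csum_dirac[OF x'])
  also have "\<dots> = csum A (mix p (\<lambda>_. dirac 0), \<lambda>_. x)"
    using dirac_in_GN by (intro csum_csum p x') auto
  also have "\<dots> = x"
    by (simp add: mix_const[OF p] csum_dirac[OF x'])
  finally show ?thesis .
qed

lemma countably_affine_const:
  assumes "super_convex_space A" "super_convex_space B" "b \<in> carrier B"
  shows "(\<lambda>_\<in>carrier A. b) \<in> countably_affine_maps A B"
proof -
  interpret A: super_convex_space A by fact
  interpret B: super_convex_space B by fact
  show ?thesis
    using assms(3) A.csum_closed B.csum_const by (auto simp: countably_affine_maps_def Pi_iff)
qed

lemma countably_affine_comp:
  assumes "super_convex_space A"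
    and "f \<in> countably_affine_maps A B" "g \<in> countably_affine_maps B C"
  shows "compose (carrier A) g f \<in> countably_affine_maps A C"
proof -
  interpret A: super_convex_space A by fact
  show ?thesis
    using assms(2,3) A.csum_closed
    by (auto simp: countably_affine_maps_def compose_def PiE_iff Pi_iff)
qed

lemma category_SCvx: "category SCvx"
proof
  fix X :: "'a scvx"
  assume "X \<in> Obj SCvx"
  then interpret super_convex_space X by (simp add: SCvx_def)
  show "Ident SCvx X \<in> Hom SCvx X X"
    using csum_closed by (auto simp: SCvx_def countably_affine_maps_def Pi_iff)
next
  fix X Y Z :: "'a scvx" and f g
  assume "X \<in> Obj SCvx" "f \<in> Hom SCvx X Y" "g \<in> Hom SCvx Y Z"
  then show "Comp SCvx X Y Z g f \<in> Hom SCvx X Z"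
    by (simp add: SCvx_def countably_affine_comp)
next
  fix X Y :: "'a scvx" and f
  assume "f \<in> Hom SCvx X Y"
  then show "Comp SCvx X Y Y (Ident SCvx Y) f = f" "Comp SCvx X X Y f (Ident SCvx X) = f"
    by (auto simp: SCvx_def countably_affine_maps_def compose_def PiE_iff fun_eq_iff
        extensional_def)
next
  fix W X Y Z :: "'a scvx" and f g h
  assume "f \<in> Hom SCvx W X"
  then show "Comp SCvx W Y Z h (Comp SCvx W X Y g f)
      = Comp SCvx W X Z (Comp SCvx X Y Z h g) f"
    by (auto simp: SCvx_def countably_affine_maps_def compose_def PiE_iff fun_eq_iff)
qed


section \<open>Density from interpolation\<close>

text \<open>
  Affinity of a function on \<open>A\<close> can be tested after composing it with affine maps out of \<open>D\<close>,
  because interpolation makes each countable sum in \<open>A\<close> the image of a countable sum of the points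
  \<open>d j\<close>. Constant maps out of \<open>D\<close> supply the function that is to be tested.
\<close>

theorem dense_if_interpolates_sequences:
  fixes D :: "'u scvx" and d :: "nat \<Rightarrow> 'u"
  assumes D: "super_convex_space D" and d: "d \<in> UNIV \<rightarrow> carrier D"
    and interp: "\<And>(A :: 'u scvx) a. \<lbrakk>super_convex_space A; a \<in> UNIV \<rightarrow> carrier A\<rbrakk>
      \<Longrightarrow> \<exists>f\<in>countably_affine_maps D A. \<forall>j. f (d j) = a j"
  shows "dense_subcategory (full_on SCvx {D}) SCvx"
proof -
  let ?Y = "restricted_yoneda SCvx (full_on SCvx {D})"
  let ?P = "functor_cat (op_cat (full_on SCvx {D})) Set_cat"
  interpret full_subcategory "full_on SCvx {D}" SCvx
    using D by (intro full_subcategory_full_on category_SCvx) (simp add: SCvx_def)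
  have d0: "d 0 \<in> carrier D" using d by auto
  have arr: "FArr ?Y (A, B) m D f = compose (carrier D) m f"
    if "super_convex_space A" "super_convex_space B"
      "m \<in> countably_affine_maps A B" "f \<in> countably_affine_maps D A" for A B m f
    using that by (simp add: restricted_yoneda_def SCvx_def full_on_def)
  show ?thesis
  proof (intro dense_subcategory.intro dense_subcategory_axioms.intro)
    show "full_subcategory (full_on SCvx {D}) SCvx" by unfold_locales
  next
    show "cat_functor SCvx ?P ?Y"
      by (rule cat_functor_restricted_yoneda)
  next
    show "faithful_functor SCvx ?P ?Y"
      unfolding faithful_functor_def
    proof (intro ballI inj_onI)
      fix A B :: "'u scvx" and m n
      assume "A \<in> Obj SCvx" "B \<in> Obj SCvx" "m \<in> Hom SCvx A B" "n \<in> Hom SCvx A B"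
        and eq: "FArr ?Y (A, B) m = FArr ?Y (A, B) n"
      then have A: "super_convex_space A" and B: "super_convex_space B"
        and m: "m \<in> countably_affine_maps A B" and n: "n \<in> countably_affine_maps A B"
        by (simp_all add: SCvx_def)
      have "m x = n x" if x: "x \<in> carrier A" for x
      proof -
        have c: "(\<lambda>_\<in>carrier D. x) \<in> countably_affine_maps D A"
          by (rule countably_affine_const[OF D A x])
        show ?thesis
          using arr[OF A B m c] arr[OF A B n c] d0
          by (metis compose_eq eq restrict_apply')
      qed
      then show "m = n"
        using m n by (auto simp: countably_affine_maps_def intro: PiE_ext)
    qed
  next
    show "full_functor SCvx ?P ?Y"
      unfolding full_functor_def
    proof (intro ballI equalityI subsetI)
      fix A B :: "'u scvx" and \<tau>
      assume A_obj: "A \<in> Obj SCvx" and B_obj: "B \<in> Obj SCvx"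
      then have A: "super_convex_space A" and B: "super_convex_space B"
        by (simp_all add: SCvx_def)
      {
        assume "\<tau> \<in> FArr ?Y (A, B) ` Hom SCvx A B"
        then show "\<tau> \<in> Hom ?P (FObj ?Y A) (FObj ?Y B)"
          using A_obj B_obj restricted_yoneda_arr[OF A_obj B_obj]
          by (auto simp: functor_cat_def) (auto simp: restricted_yoneda_def)
      next
        assume "\<tau> \<in> Hom ?P (FObj ?Y A) (FObj ?Y B)"
        then have nt: "\<tau> \<in> nat_trans (op_cat (full_on SCvx {D})) Set_cat
            (restricted_hom SCvx (full_on SCvx {D}) A) (restricted_hom SCvx (full_on SCvx {D}) B)"
          using A_obj B_obj by (simp add: functor_cat_def restricted_yoneda_def)
        define t where "t = \<tau> D"
        have \<tau>_ext: "\<tau> \<in> extensional {D}"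
          and t_type: "t \<in> countably_affine_maps D A \<rightarrow>\<^sub>E countably_affine_maps D B"
          using nt
          by (auto simp: t_def nat_trans_def restricted_hom_def op_cat_def Set_cat_def full_on_def
              SCvx_def PiE_iff)
        have t_natural: "t (compose (carrier D) f u) = compose (carrier D) (t f) u"
          if f: "f \<in> countably_affine_maps D A" and u: "u \<in> countably_affine_maps D D" for f u
        proof -
          have "compose (countably_affine_maps D A) t
                (\<lambda>f\<in>countably_affine_maps D A. compose (carrier D) f u)
              = compose (countably_affine_maps D A)
                (\<lambda>f\<in>countably_affine_maps D B. compose (carrier D) f u) t"
            using nt u
            by (simp add: t_def nat_trans_def restricted_hom_def op_cat_def Set_cat_def full_on_def
                SCvx_def)
          from fun_cong[OF this, of f] show ?thesis
            using f t_type by (auto simp: compose_def PiE_iff)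
        qed
        have const: "(\<lambda>_\<in>carrier D. x) \<in> countably_affine_maps D A" if "x \<in> carrier A" for x
          by (rule countably_affine_const[OF D A that])
        (* Constant maps stand for points of A, and evaluating at d 0 turns the constant map that
           \<tau> returns back into a point of B. *)
        define m where "m = (\<lambda>x\<in>carrier A. t (\<lambda>_\<in>carrier D. x) (d 0))"
        have t_eq: "t f y = m (f y)"
          if f: "f \<in> countably_affine_maps D A" and y: "y \<in> carrier D" for f y
        proof -
          (* Restricting f along the constant endomap at y replaces f by the constant map at f y,
             which is the only kind of map that the definition of m mentions. *)
          let ?u = "\<lambda>_\<in>carrier D. y"
          have u: "?u \<in> countably_affine_maps D D"
            by (rule countably_affine_const[OF D D y])
          have fy: "f y \<in> carrier A"
            using f y by (auto simp: countably_affine_maps_def)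
          have "compose (carrier D) f ?u = (\<lambda>_\<in>carrier D. f y)"
            by (auto simp: compose_def fun_eq_iff)
          then have "m (f y) = t (compose (carrier D) f ?u) (d 0)"
            using fy by (simp add: m_def)
          also have "\<dots> = t f y"
            using d0 by (simp add: t_natural[OF f u] compose_eq)
          finally show ?thesis by simp
        qed
        have m_type: "m \<in> carrier A \<rightarrow>\<^sub>E carrier B"
          using t_type const d0
          by (auto simp: m_def PiE_iff countably_affine_maps_def Pi_iff)
        have "m (csum A (p, a)) = csum B (p, \<lambda>j. m (a j))"
          if p: "p \<in> GN" and a: "a \<in> UNIV \<rightarrow> carrier A" for p a
        proof -
          obtain f where f: "f \<in> countably_affine_maps D A" and fd: "\<And>j. f (d j) = a j"
            using interp[OF A a] by blast
          have tf: "t f \<in> countably_affine_maps D B"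
            using t_type f by auto
          have "m (csum A (p, a)) = m (f (csum D (p, d)))"
            using f p d by (simp add: countably_affine_maps_def fd)
          also have "\<dots> = t f (csum D (p, d))"
            using t_eq[OF f] super_convex_space.csum_closed[OF D p d] by simp
          also have "\<dots> = csum B (p, \<lambda>j. t f (d j))"
            using tf p d by (simp add: countably_affine_maps_def)
          also have "\<dots> = csum B (p, \<lambda>j. m (a j))"
            using t_eq[OF f] d by (auto simp: fd Pi_iff)
          finally show ?thesis .
        qed
        then have m: "m \<in> countably_affine_maps A B"
          using m_type by (simp add: countably_affine_maps_def)
        have "FArr ?Y (A, B) m = \<tau>"
        proof (rule extensionalityI)
          show "FArr ?Y (A, B) m \<in> extensional {D}"
            using A B m by (simp add: restricted_yoneda_def SCvx_def full_on_def)
          fix X assume "X \<in> {D}"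
          then have X: "X = D" by simp
          have "FArr ?Y (A, B) m D = t"
          proof (rule extensionalityI)
            show "FArr ?Y (A, B) m D \<in> extensional (countably_affine_maps D A)"
              using A B m by (simp add: restricted_yoneda_def SCvx_def full_on_def)
            show "t \<in> extensional (countably_affine_maps D A)"
              using t_type by (simp add: PiE_iff)
            fix f assume f: "f \<in> countably_affine_maps D A"
            have "t f \<in> extensional (carrier D)"
              using t_type f by (auto simp: countably_affine_maps_def PiE_iff)
            then show "FArr ?Y (A, B) m D f = t f"
              unfolding arr[OF A B m f]
              by (intro extensionalityI[of _ "carrier D"]) (auto simp: compose_eq t_eq[OF f])
          qed
          then show "FArr ?Y (A, B) m X = \<tau> X" by (simp add: X t_def)
        qed (rule \<tau>_ext)
        then show "\<tau> \<in> FArr ?Y (A, B) ` Hom SCvx A B"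
          using m by (auto simp: SCvx_def)
      }
    qed
  qed
qed


section \<open>The space of probability measures on the natural numbers\<close>

text \<open>
  Tonelli's theorem for series. Sums over \<open>nat \<times> nat\<close> do not depend on an order of summation, so
  the row-wise total determines the unordered sum, and this in turn the column-wise total.
\<close>

lemma sums_interchange_nonneg:
  fixes f :: "nat \<Rightarrow> nat \<Rightarrow> real"
  assumes nonneg: "\<And>i j. 0 \<le> f i j" and rows: "\<And>i. f i sums r i" and total: "r sums s"
  shows "(\<lambda>j. \<Sum>i. f i j) sums s"
proof -
  have le: "f i j \<le> r i" for i j
    using sum_le_suminf[of "f i" "{j}"] rows[of i] nonneg by (auto simp: sums_iff)
  have col: "summable (\<lambda>i. f i j)" for j
    by (rule summable_comparison_test'[of r 0]) (use total le nonneg in \<open>auto simp: sums_iff\<close>)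
  have r_nonneg: "0 \<le> r i" for i
    using le[of i 0] nonneg[of i 0] by linarith
  have rows': "((\<lambda>j. (\<lambda>(i, j). f i j) (i, j)) has_sum r i) UNIV" for i
    using sums_nonneg_imp_has_sum[OF rows] nonneg by simp
  have total': "(r has_sum s) UNIV"
    by (rule sums_nonneg_imp_has_sum[OF total r_nonneg])
  have "(\<lambda>(i, j). f i j) summable_on UNIV \<times> UNIV"
    by (rule summable_on_SigmaI[where g = r])
      (use nonneg rows' total' in \<open>auto simp: summable_on_def\<close>)
  then have "((\<lambda>(i, j). f i j) has_sum s) (UNIV \<times> UNIV)"
    using rows' total' by (intro has_sum_SigmaI[where g = r]) simp_all
  then have swapped: "((\<lambda>(j, i). f i j) has_sum s) (UNIV \<times> UNIV)"
    by (subst (asm) has_sum_swap) simp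
  have "((\<lambda>j. \<Sum>i. f i j) has_sum s) UNIV"
  proof (rule has_sum_SigmaD[OF swapped])
    fix j
    show "((\<lambda>i. case (j, i) of (j, i) \<Rightarrow> f i j) has_sum (\<Sum>i. f i j)) UNIV"
      using sums_nonneg_imp_has_sum[OF summable_sums[OF col[of j]]] nonneg by simp
  qed
  then show ?thesis
    by (rule has_sum_imp_sums)
qed

lemma GN_I:
  assumes "\<And>i. 0 \<le> p i" "p sums 1"
  shows "p \<in> GN"
proof -
  have "p i \<le> 1" for i
    using sum_le_suminf[of p "{i}"] assms by (auto simp: sums_iff)
  then show ?thesis using assms by (simp add: GN_def)
qed

lemma mix_summable:
  assumes "p \<in> GN" "Q \<in> UNIV \<rightarrow> GN"
  shows "summable (\<lambda>j. p j * Q j i)"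
proof (rule summable_comparison_test'[of p 0])
  show "summable p" using assms by (auto simp: GN_def sums_iff)
  show "norm (p j * Q j i) \<le> p j" for j
    using assms by (auto simp: GN_def Pi_iff abs_mult mult_left_le)
qed

lemma mix_in_GN:
  assumes p: "p \<in> GN" and Q: "Q \<in> UNIV \<rightarrow> GN"
  shows "mix p Q \<in> GN"
proof (rule GN_I)
  have nonneg: "0 \<le> p j * Q j i" for i j
    using p Q by (auto simp: GN_def Pi_iff)
  show "0 \<le> mix p Q i" for i
    unfolding mix_def using mix_summable[OF p Q] nonneg by (intro suminf_nonneg) auto
  have "(\<lambda>i. p j * Q j i) sums p j" for j
    using sums_mult[of "Q j" 1 "p j"] Q by (auto simp: GN_def Pi_iff)
  then show "mix p Q sums 1"
    unfolding mix_def
    using p by (intro sums_interchange_nonneg[of _ p] nonneg) (auto simp: GN_def)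
qed

text \<open>
  Both sides at \<open>k\<close> are iterated sums of \<open>p j * (Q j i * R i k)\<close>, over \<open>i\<close> first and over \<open>j\<close>
  first. This is axiom (2) for the coefficientwise sums.
\<close>

lemma mix_mix:
  assumes p: "p \<in> GN" and Q: "Q \<in> UNIV \<rightarrow> GN" and R: "R \<in> UNIV \<rightarrow> GN"
  shows "mix p (\<lambda>j. mix (Q j) R) = mix (mix p Q) R"
proof
  fix k
  let ?f = "\<lambda>j i. p j * (Q j i * R i k)"
  have nonneg: "0 \<le> ?f j i" for i j
    using p Q R by (auto simp: GN_def Pi_iff)
  have rows: "?f j sums (p j * mix (Q j) R k)" for j
    unfolding mix_def using mix_summable[of "Q j" R k] Q R
    by (intro sums_mult summable_sums) auto
  have "(\<lambda>j. mix (Q j) R) \<in> UNIV \<rightarrow> GN"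
    using Q R mix_in_GN by auto
  then have total: "(\<lambda>j. p j * mix (Q j) R k) sums mix p (\<lambda>j. mix (Q j) R) k"
    unfolding mix_def[of p] by (intro summable_sums mix_summable p)
  have "(\<Sum>j. ?f j i) = mix p Q i * R i k" for i
    using suminf_mult2[OF mix_summable[OF p Q, of i], of "R i k"]
    by (simp add: mix_def mult.assoc)
  then have "(\<lambda>i. mix p Q i * R i k) sums mix p (\<lambda>j. mix (Q j) R) k"
    using sums_interchange_nonneg[OF nonneg rows total] by simp
  then show "mix p (\<lambda>j. mix (Q j) R) k = mix (mix p Q) R k"
    by (simp add: mix_def[of "mix p Q"] sums_iff)
qed

lemma super_convex_Delta_N: "super_convex_space Delta_N"
proof
  show "csum Delta_N \<in> GN \<times> (UNIV \<rightarrow> carrier Delta_N) \<rightarrow>\<^sub>E carrier Delta_N"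
    using mix_in_GN by (auto simp: Delta_N_def)
next
  fix a :: "nat \<Rightarrow> nat \<Rightarrow> real" and j
  assume "a \<in> UNIV \<rightarrow> carrier Delta_N"
  then show "csum Delta_N (dirac j, a) = a j"
    by (simp add: Delta_N_def dirac_in_GN mix_dirac_left)
next
  fix p :: "nat \<Rightarrow> real" and Q :: "nat \<Rightarrow> nat \<Rightarrow> real" and a :: "nat \<Rightarrow> nat \<Rightarrow> real"
  assume p: "p \<in> GN" and Q: "Q \<in> UNIV \<rightarrow> GN" and "a \<in> UNIV \<rightarrow> carrier Delta_N"
  then have a: "a \<in> UNIV \<rightarrow> GN" by (simp add: Delta_N_def)
  have "mix (Q j) a \<in> GN" "Q j \<in> GN" for j
    using Q a mix_in_GN by auto
  then show "csum Delta_N (p, \<lambda>j. csum Delta_N (Q j, a)) = csum Delta_N (mix p Q, a)"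
    using p a mix_in_GN[OF p Q] by (simp add: Delta_N_def mix_mix[OF p Q a])
qed

text \<open>
  Axiom (2) of a super convex space says exactly that a sum along a fixed sequence is affine in
  its weights.
\<close>

lemma countably_affine_csum:
  assumes "super_convex_space A" and a: "a \<in> UNIV \<rightarrow> carrier A"
  shows "(\<lambda>p\<in>GN. csum A (p, a)) \<in> countably_affine_maps Delta_N A"
proof -
  interpret super_convex_space A by fact
  have "csum A (mix p Q, a) = csum A (p, \<lambda>j. csum A (Q j, a))"
    if "p \<in> GN" "Q \<in> UNIV \<rightarrow> GN" for p Q
    using csum_csum[OF that a] by simp
  then show ?thesis
    using a csum_closed mix_in_GN
    by (auto simp: countably_affine_maps_def Delta_N_def Pi_iff)
qed


section \<open>Renaming points\<close>

lemma super_convex_relabel: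
  assumes "super_convex_space A" and inj: "inj_on e (carrier A)"
  shows "super_convex_space (relabel e A)"
proof -
  interpret super_convex_space A by fact
  let ?i = "inv_into (carrier A) e"
  have i: "(\<lambda>j. ?i (a j)) \<in> UNIV \<rightarrow> carrier A" if "a \<in> UNIV \<rightarrow> e ` carrier A" for a :: "nat \<Rightarrow> _"
    using that inv_into_into[of _ e "carrier A"] by (auto simp: Pi_iff)
  show ?thesis
  proof
    show "csum (relabel e A) \<in> GN \<times> (UNIV \<rightarrow> carrier (relabel e A)) \<rightarrow>\<^sub>E carrier (relabel e A)"
      using csum_closed i by (auto simp: relabel_def)
  next
    fix a :: "nat \<Rightarrow> _" and j
    assume "a \<in> UNIV \<rightarrow> carrier (relabel e A)"
    then have a: "a \<in> UNIV \<rightarrow> e ` carrier A" by (simp add: relabel_def)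
    then have "e (?i (a j)) = a j" by (intro f_inv_into_f) auto
    then show "csum (relabel e A) (dirac j, a) = a j"
      using a by (simp add: relabel_def dirac_in_GN csum_dirac[OF i[OF a]])
  next
    fix p :: "nat \<Rightarrow> real" and Q :: "nat \<Rightarrow> nat \<Rightarrow> real" and a :: "nat \<Rightarrow> _"
    assume p: "p \<in> GN" and Q: "Q \<in> UNIV \<rightarrow> GN" and "a \<in> UNIV \<rightarrow> carrier (relabel e A)"
    then have a: "a \<in> UNIV \<rightarrow> e ` carrier A" by (simp add: relabel_def)
    have c: "csum A (Q j, \<lambda>k. ?i (a k)) \<in> carrier A" "Q j \<in> GN" for j
      using csum_closed[OF _ i[OF a]] Q by auto
    show "csum (relabel e A) (p, \<lambda>j. csum (relabel e A) (Q j, a))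
        = csum (relabel e A) (mix p Q, a)"
      using p a c mix_in_GN[OF p Q] csum_csum[OF p Q i[OF a]]
      by (simp add: relabel_def inv_into_f_f[OF inj])
  qed
qed

lemma countably_affine_relabel_inverse:
  assumes "super_convex_space A" and inj: "inj_on e (carrier A)"
  shows "(\<lambda>x\<in>e ` carrier A. inv_into (carrier A) e x) \<in> countably_affine_maps (relabel e A) A"
proof -
  interpret super_convex_space A by fact
  have "(\<lambda>j. inv_into (carrier A) e (a j)) \<in> UNIV \<rightarrow> carrier A"
    if "a \<in> UNIV \<rightarrow> e ` carrier A" for a :: "nat \<Rightarrow> _"
    using that inv_into_into[of _ e "carrier A"] by (auto simp: Pi_iff)
  then show ?thesis
    using csum_closed inj
    by (auto simp: countably_affine_maps_def relabel_def Pi_iff inv_into_into)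
qed


section \<open>Density of the space of probability measures\<close>

theorem lemma4p2:
  fixes e :: "(nat \<Rightarrow> real) \<Rightarrow> 'u"
  assumes "inj_on e (carrier Delta_N)"
  shows "dense_subcategory (full_on SCvx {relabel e Delta_N}) (SCvx :: ('u scvx, 'u \<Rightarrow> 'u) cat)"
proof (rule dense_if_interpolates_sequences[where d = "\<lambda>j. e (dirac j)"])
  let ?D = "relabel e Delta_N"
  show D: "super_convex_space ?D"
    by (rule super_convex_relabel[OF super_convex_Delta_N assms])
  show "(\<lambda>j. e (dirac j)) \<in> UNIV \<rightarrow> carrier ?D"
    using dirac_in_GN by (auto simp: relabel_def Delta_N_def)
  fix A :: "'u scvx" and a :: "nat \<Rightarrow> 'u"
  assume A: "super_convex_space A" and a: "a \<in> UNIV \<rightarrow> carrier A"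
  (* Undo the renaming, then sum along a with the resulting weights. *)
  let ?r = "\<lambda>x\<in>e ` carrier Delta_N. inv_into (carrier Delta_N) e x"
  let ?f = "compose (carrier ?D) (\<lambda>p\<in>GN. csum A (p, a)) ?r"
  have "?f \<in> countably_affine_maps ?D A"
    by (rule countably_affine_comp[OF D countably_affine_relabel_inverse[OF super_convex_Delta_N assms]
          countably_affine_csum[OF A a]])
  moreover have "?f (e (dirac j)) = a j" for j
  proof -
    have "dirac j \<in> carrier Delta_N" by (simp add: Delta_N_def dirac_in_GN)
    then show ?thesis
      using assms super_convex_space.csum_dirac[OF A a]
      by (simp add: compose_eq relabel_def dirac_in_GN)
  qed
  ultimately show "\<exists>f\<in>countably_affine_maps ?D A. \<forall>j. f (e (dirac j)) = a j"
    by blast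
qed

end
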